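(* Let $L=0$, $k\in[0,1)$ and $p=\max\left(\frac{1+k}{3-k},\frac{k+k^2}{1+k^2}\right)$. The randomized mechanism RandMaxCost, which for every location profile $\mathbf x$ returns the edge $(x_r,y_l)$ with probability $p$ and the edge $\left(\frac{x_r}{2},\frac{y_l+1}{2}\right)$ with probability $1-p$, is group strategyproof, and its approximation ratio for the maximum cost is $\max\left(\frac{4-2k}{3-k},\frac{1+k}{1+k^2}\right)$.
   Context: Setting ($L=0$). Fix a constant $k\in[0,1)$ and a point obstacle $o\in(0,1)$. Agents $N=\{1,\ldots,n\}$ have locations $x_i\in[0,o)\cup(o,1]$; $N_1=\{i: x_i<o\}$ and $N_2=\{i: x_i>o\}$, both nonempty. An edge is a pair $(a,b)$ with $a\in[0,o)$, $b\in(o,1]$. The cost of agent $i\in N_1$ is $cost(a,b,x_i)=|x_i-a|+k(b-a)+(1-b)$; the cost of agent $i\in N_2$ is $cost(a,b,x_i)=|x_i-b|+k(b-a)+a$. The maximum cost is $MC(a,b,\mathbf x)=\max_{i\in N}cost(a,b,x_i)$. Write $x_r=\max\{x_i: i\in N_1\}$ and $y_l=\min\{x_j: j\in N_2\}$. A randomized mechanism $f$ maps each location profile to a probability distribution $P$ over edges; the cost of agent $i$ is $cost(P,x_i)=\mathbb E_{(a,b)\sim P}[cost(a,b,x_i)]$, and the maximum cost of the mechanism is the expected maximum cost $\mathbb E_{(a,b)\sim P}[MC(a,b,\mathbf x)]$. It is group strategyproof if for every nonempty $S\subseteq N$, every profile $\mathbf x$ and every joint misreport $\mathbf x_S'$ of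 the agents in $S$ (each agent reporting a location in its own region), there is $i\in S$ with $cost(f(\mathbf x),x_i)\le cost(f(\mathbf x_S',\mathbf x_{-S}),x_i)$. Its approximation ratio is the least $\alpha$ such that its expected maximum cost is at most $\alpha\cdot\min_{(a,b)}MC(a,b,\mathbf x)$ (minimum over all edges) for all $o$ and all profiles $\mathbf x$. *)

theory Defs
  imports "HOL-Probability.Probability"
begin

text \<open>
  Agents are the numbers in \<open>{1..n}\<close>; a location profile is a function on \<open>nat\<close> of which only the
  values on \<open>{1..n}\<close> matter. The obstacle is the point \<open>obs\<close>. Each agent's region is determined by
  its true location.
\<close>

definition region :: "real \<Rightarrow> real \<Rightarrow> real set" where
  "region obs z = (if z < obs then {0..<obs} else {obs<..1})"

definition left_agents :: "nat \<Rightarrow> real \<Rightarrow> (nat \<Rightarrow> real) \<Rightarrow> nat set" where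
  "left_agents n obs x = {i \<in> {1..n}. x i < obs}"

definition right_agents :: "nat \<Rightarrow> real \<Rightarrow> (nat \<Rightarrow> real) \<Rightarrow> nat set" where
  "right_agents n obs x = {i \<in> {1..n}. obs < x i}"

definition profiles :: "nat \<Rightarrow> real \<Rightarrow> (nat \<Rightarrow> real) set" where
  "profiles n obs = {x. (\<forall>i\<in>{1..n}. x i \<in> {0..<obs} \<union> {obs<..1}) \<and>
     left_agents n obs x \<noteq> {} \<and> right_agents n obs x \<noteq> {}}"

definition edges :: "real \<Rightarrow> (real \<times> real) set" where
  "edges obs = {0..<obs} \<times> {obs<..1}"

definition cost :: "real \<Rightarrow> real \<Rightarrow> real \<times> real \<Rightarrow> real \<Rightarrow> real" where
  "cost k obs e z = (case e of (a, b) \<Rightarrow>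
     if z < obs then \<bar>z - a\<bar> + k * (b - a) + (1 - b)
     else \<bar>z - b\<bar> + k * (b - a) + a)"

definition max_cost :: "nat \<Rightarrow> real \<Rightarrow> real \<Rightarrow> real \<times> real \<Rightarrow> (nat \<Rightarrow> real) \<Rightarrow> real" where
  "max_cost n k obs e x = (MAX i\<in>{1..n}. cost k obs e (x i))"

text \<open>
  The infimum below is a minimum (\<open>opt_max_cost_attained\<close>), although the set of edges is not closed.
\<close>

definition opt_max_cost :: "nat \<Rightarrow> real \<Rightarrow> real \<Rightarrow> (nat \<Rightarrow> real) \<Rightarrow> real" where
  "opt_max_cost n k obs x = (INF e\<in>edges obs. max_cost n k obs e x)"

definition x_r :: "nat \<Rightarrow> real \<Rightarrow> (nat \<Rightarrow> real) \<Rightarrow> real" where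
  "x_r n obs x = (MAX i\<in>left_agents n obs x. x i)"

definition y_l :: "nat \<Rightarrow> real \<Rightarrow> (nat \<Rightarrow> real) \<Rightarrow> real" where
  "y_l n obs x = (MIN i\<in>right_agents n obs x. x i)"

text \<open>
  A mechanism for a fixed obstacle maps profiles to distributions over edges. Only discrete
  distributions are needed, hence \<open>pmf\<close>.
\<close>

type_synonym mechanism = "(nat \<Rightarrow> real) \<Rightarrow> (real \<times> real) pmf"

definition randomized_mechanism :: "nat \<Rightarrow> real \<Rightarrow> mechanism \<Rightarrow> bool" where
  "randomized_mechanism n obs f \<longleftrightarrow> (\<forall>x\<in>profiles n obs. set_pmf (f x) \<subseteq> edges obs)"

definition expected_cost :: "real \<Rightarrow> real \<Rightarrow> (real \<times> real) pmf \<Rightarrow> real \<Rightarrow> real" where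
  "expected_cost k obs P z = measure_pmf.expectation P (\<lambda>e. cost k obs e z)"

definition expected_max_cost ::
    "nat \<Rightarrow> real \<Rightarrow> real \<Rightarrow> (real \<times> real) pmf \<Rightarrow> (nat \<Rightarrow> real) \<Rightarrow> real" where
  "expected_max_cost n k obs P x = measure_pmf.expectation P (\<lambda>e. max_cost n k obs e x)"

text \<open>\<open>override_on x x' S\<close> is the profile in which \<open>S\<close> reports \<open>x'\<close> and the other agents \<open>x\<close>.\<close>

definition group_strategyproof :: "nat \<Rightarrow> real \<Rightarrow> real \<Rightarrow> mechanism \<Rightarrow> bool" where
  "group_strategyproof n k obs f \<longleftrightarrow>
     (\<forall>S x x'. S \<noteq> {} \<longrightarrow> S \<subseteq> {1..n} \<longrightarrow> x \<in> profiles n obs \<longrightarrow>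
        (\<forall>i\<in>S. x' i \<in> region obs (x i)) \<longrightarrow>
        (\<exists>i\<in>S. expected_cost k obs (f x) (x i)
               \<le> expected_cost k obs (f (override_on x x' S)) (x i)))"

text \<open>Here \<open>F obs\<close> is the mechanism used when the obstacle is at \<open>obs\<close>.\<close>

definition approximates :: "nat \<Rightarrow> real \<Rightarrow> (real \<Rightarrow> mechanism) \<Rightarrow> real \<Rightarrow> bool" where
  "approximates n k F \<alpha> \<longleftrightarrow>
     (\<forall>obs\<in>{0<..<1}. \<forall>x\<in>profiles n obs.
        expected_max_cost n k obs (F obs x) x \<le> \<alpha> * opt_max_cost n k obs x)"

definition is_approximation_ratio :: "nat \<Rightarrow> real \<Rightarrow> (real \<Rightarrow> mechanism) \<Rightarrow> real \<Rightarrow> bool" where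
  "is_approximation_ratio n k F \<alpha> \<longleftrightarrow>
     approximates n k F \<alpha> \<and> (\<forall>\<beta>. approximates n k F \<beta> \<longrightarrow> \<alpha> \<le> \<beta>)"

definition rand_prob :: "real \<Rightarrow> real" where
  "rand_prob k = max ((1 + k) / (3 - k)) ((k + k\<^sup>2) / (1 + k\<^sup>2))"

text \<open>By \<open>rand_prob_bounds\<close>, the parameter of \<open>bernoulli_pmf\<close> is a genuine probability.\<close>

definition RandMaxCost :: "nat \<Rightarrow> real \<Rightarrow> real \<Rightarrow> mechanism" where
  "RandMaxCost n k obs x =
     map_pmf (\<lambda>c. if c then (x_r n obs x, y_l n obs x)
                  else (x_r n obs x / 2, (y_l n obs x + 1) / 2))
       (bernoulli_pmf (rand_prob k))"

lemma rand_prob_bounds: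
  assumes "0 \<le> k" "k < 1"
  shows "0 \<le> rand_prob k" "rand_prob k \<le> 1"
proof -
  have "(1 + k) / (3 - k) \<ge> 0" using assms by simp
  then show "0 \<le> rand_prob k" unfolding rand_prob_def by simp
  have "(1 + k) / (3 - k) \<le> 1" using assms by (simp add: field_simps)
  moreover have "(k + k\<^sup>2) / (1 + k\<^sup>2) \<le> 1" 
    using assms by (subst divide_le_eq_1_pos) (simp_all add: add_pos_nonneg)
  ultimately show "rand_prob k \<le> 1" unfolding rand_prob_def by simp
qed

lemma continuous_on_Max_image:
  fixes g :: "'b::topological_space \<Rightarrow> 'i \<Rightarrow> real"
  assumes "finite I" "I \<noteq> {}" "\<And>i. i \<in> I \<Longrightarrow> continuous_on T (\<lambda>e. g e i)"
  shows "continuous_on T (\<lambda>e. MAX i\<in>I. g e i)"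
  using assms
proof (induction I rule: finite_ne_induct)
  case (singleton i)
  then show ?case by simp
next
  case (insert i I)
  have "continuous_on T (\<lambda>e. max (g e i) (MAX j\<in>I. g e j))"
    using insert by (intro continuous_on_max) auto
  then show ?case using insert.hyps by simp
qed

lemma Max_mono_image:
  fixes g h :: "'i \<Rightarrow> real"
  assumes "finite I" "I \<noteq> {}" "\<And>i. i \<in> I \<Longrightarrow> g i \<le> h i"
  shows "(MAX i\<in>I. g i) \<le> (MAX i\<in>I. h i)"
proof (rule Max.boundedI)
  fix y assume "y \<in> g ` I"
  then obtain i where i: "i \<in> I" "y = g i" by blast
  have "h i \<le> (MAX i\<in>I. h i)" using assms(1) i(1) by (intro Max_ge) auto
  then show "y \<le> (MAX i\<in>I. h i)" using assms(3)[OF i(1)] i(2) by simp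
qed (use assms in auto)

lemma opt_max_cost_attained:
  assumes k: "0 \<le> k" "k < 1" and obs: "0 < obs" "obs < 1" and x: "x \<in> profiles n obs"
  shows "\<exists>e\<in>edges obs. opt_max_cost n k obs x = max_cost n k obs e x \<and>
           (\<forall>e'\<in>edges obs. max_cost n k obs e x \<le> max_cost n k obs e' x)"
proof -
  let ?f = "\<lambda>e. max_cost n k obs e x"
  let ?r = "x_r n obs x" and ?l = "y_l n obs x"
  have finL: "finite (left_agents n obs x)" and finR: "finite (right_agents n obs x)"
    by (simp_all add: left_agents_def right_agents_def)
  have neL: "left_agents n obs x \<noteq> {}" and neR: "right_agents n obs x \<noteq> {}"
    using x by (auto simp: profiles_def)
  have r_in: "?r \<in> x ` left_agents n obs x"
    unfolding x_r_def using finL neL by (intro Max_in) auto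
  have l_in: "?l \<in> x ` right_agents n obs x"
    unfolding y_l_def using finR neR by (intro Min_in) auto
  have r: "0 \<le> ?r" "?r < obs"
    using r_in x by (fastforce simp: profiles_def left_agents_def)+
  obtain j where "j \<in> {1..n}" "obs < x j" "?l = x j"
    using l_in by (auto simp: right_agents_def)
  then have l: "obs < ?l" "?l \<le> 1"
    using x by (force simp: profiles_def)+
  have r_ge: "x i \<le> ?r" if "i \<in> {1..n}" "x i < obs" for i
    unfolding x_r_def using finL that by (intro Max_ge) (auto simp: left_agents_def)
  have l_le: "?l \<le> x i" if "i \<in> {1..n}" "obs < x i" for i
    unfolding y_l_def using finR that by (intro Min_le) (auto simp: right_agents_def)
  have ne: "{1..n} \<noteq> {}" using neL unfolding left_agents_def by blast
  let ?K = "{0..?r} \<times> {?l..1}"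
  have "continuous_on ?K (\<lambda>e. cost k obs e z)" for z
    unfolding cost_def case_prod_beta
    by (cases "z < obs") (auto intro!: continuous_intros)
  then have "continuous_on ?K ?f"
    unfolding max_cost_def using ne by (intro continuous_on_Max_image) auto
  moreover have "compact ?K" by (intro compact_Times) auto
  moreover have "?K \<noteq> {}" using r l by auto
  ultimately obtain e where e: "e \<in> ?K" "\<And>e'. e' \<in> ?K \<Longrightarrow> ?f e \<le> ?f e'"
    using continuous_attains_inf[of ?K ?f] by blast
  have mono: "?f (min a ?r, max b ?l) \<le> ?f (a, b)" if "(a, b) \<in> edges obs" for a b
  proof -
    have "cost k obs (min a ?r, max b ?l) (x i) \<le> cost k obs (a, b) (x i)" 
      if i: "i \<in> {1..n}" for i
    proof -
      define s where "s = a - min a ?r"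
      define t where "t = max b ?l - b"
      have st: "s \<ge> 0" "t \<ge> 0" by (auto simp: s_def t_def)
      have ks: "0 \<le> k * s" "k * s \<le> s" "0 \<le> k * t" "k * t \<le> t"
        using k st by (auto intro: mult_left_le_one_le)
      have ab: "min a ?r = a - s" "max b ?l = b + t" by (auto simp: s_def t_def)
      have eq: "k * ((b + t) - (a - s)) = k * (b - a) + k * t + k * s"
        by (simp add: algebra_simps)
      show ?thesis
      proof (cases "x i < obs")
        case True
        have "\<bar>x i - (a - s)\<bar> + s = \<bar>x i - a\<bar>"
          using r_ge[OF i True] by (auto simp: s_def min_def)
        then show ?thesis unfolding cost_def ab using True ks by (simp add: eq)
      next
        case False
        then have gt: "obs < x i" using x i by (force simp: profiles_def)
        have "\<bar>x i - (b + t)\<bar> + t = \<bar>x i - b\<bar>"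
          using l_le[OF i gt] by (auto simp: t_def max_def)
        then show ?thesis unfolding cost_def ab using False ks by (simp add: eq)
      qed
    qed
    then show ?thesis
      unfolding max_cost_def using ne by (intro Max_mono_image) auto
  qed
  have in_K: "(min a ?r, max b ?l) \<in> ?K" if "(a, b) \<in> edges obs" for a b
    using that r l by (auto simp: edges_def)
  have le: "?f e \<le> ?f e'" if "e' \<in> edges obs" for e'
  proof -
    obtain a b where ab: "e' = (a, b)" by (cases e')
    have "?f e \<le> ?f (min a ?r, max b ?l)" using that ab by (intro e(2) in_K) simp
    also have "\<dots> \<le> ?f e'" using that ab mono by simp
    finally show ?thesis .
  qed
  have e_in: "e \<in> edges obs" using e(1) r l by (auto simp: edges_def)
  have "opt_max_cost n k obs x = ?f e"
    unfolding opt_max_cost_def using le e_in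
    by (intro cInf_eq_minimum) auto
  then show ?thesis using e_in le by blast
qed

end

theory Submission
  imports Defs
begin

text \<open>
  Measure every location by its distance to the endpoint of its own region, and let \<open>r\<close>, \<open>s\<close> be
  the distances of \<open>x_r\<close>, \<open>y_l\<close>. Both sides of the obstacle then have the same cost function
  \<open>end_cost\<close>, with the roles of \<open>r\<close> and \<open>s\<close> exchanged.

  Group strategyproofness: the bound \<open>p \<ge> (1 + k) / (3 - k)\<close> says exactly that pushing \<open>r\<close> or \<open>s\<close>
  towards the obstacle never helps anybody. Lowering \<open>r\<close> requires the agent at \<open>r\<close>; if both \<open>r\<close> and
  \<open>s\<close> go down, the cost changes of the two extreme agents sum to a nonnegative number.

  Approximation: with \<open>D = r + s\<close> and \<open>m\<close> the least distance, the expected maximum cost is at most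
  \<open>k + (1 - k) (1 + p) D / 2 - p m\<close>, whereas averaging the costs of the agents at \<open>r\<close>, \<open>s\<close>, \<open>m\<close>
  with weights \<open>(1 - k) / 2\<close>, \<open>(1 - k) / 2\<close>, \<open>k\<close> bounds the optimum below by
  \<open>k + (1 - k) D / 2 - k m\<close>. As \<open>p \<ge> (k + k\<^sup>2) / (1 + k\<^sup>2)\<close>, the worst case is \<open>m = 0\<close>, \<open>D \<rightarrow> 1\<close>,
  and it is approached with one agent at \<open>0\<close>, the others close to the obstacle, and the obstacle
  close to \<open>0\<close>.
\<close>

section \<open>Costs in distance coordinates\<close>

text \<open>Rearrangement of \<bar>z - a\<bar> + k * (1 - a - b) + b, where \<open>a\<close> and
  \<open>b\<close> are the distances of the edge's two ends from the endpoints of their regions and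
  \<open>a\<close> is the end on the agent's side.\<close>

definition end_cost :: "real \<Rightarrow> real \<Rightarrow> real \<Rightarrow> real \<Rightarrow> real" where
  "end_cost k z a b = \<bar>z - a\<bar> - k * a + k + (1 - k) * b"

lemma cost_left: "z < obs \<Longrightarrow> cost k obs (a, b) z = end_cost k z a (1 - b)"
  by (simp add: cost_def end_cost_def algebra_simps)

lemma cost_right: "obs < z \<Longrightarrow> cost k obs (a, b) z = end_cost k (1 - z) (1 - b) a"
  by (simp add: cost_def end_cost_def algebra_simps abs_minus_commute)

definition mixed_cost :: "real \<Rightarrow> real \<Rightarrow> real \<Rightarrow> real \<Rightarrow> real \<Rightarrow> real" where
  "mixed_cost k p z r s = p * end_cost k z r s + (1 - p) * end_cost k z (r / 2) (s / 2)"

text \<open>Raising \<open>r\<close> by \<delta> adds exactly (1 - k) * \<delta> to the cost of the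
  first edge, while the halved edge saves at most (1 + k) * \<delta> / 2. The expected balance is at
  least (p * (3 - k) - (1 + k)) / 2 * \<delta>, which the bound on \<open>p\<close> makes
  nonnegative. Raising \<open>s\<close> makes both edges dearer.\<close>

lemma mixed_cost_mono:
  assumes k: "0 \<le> k" "k < 1" and p: "(1 + k) / (3 - k) \<le> p" "p \<le> 1"
    and "z \<le> r" "r \<le> r'" "s \<le> s'"
  shows "mixed_cost k p z r s \<le> mixed_cost k p z r' s'"
proof -
  have p0: "0 \<le> p"
    using k p(1) by (smt (verit) divide_nonneg_nonneg)
  have "1 + k \<le> p * (3 - k)"
    using p(1) k by (simp add: pos_divide_le_eq)
  then have "0 \<le> (p * (3 - k) - (1 + k)) / 2 * (r' - r)"
    using assms by (intro mult_nonneg_nonneg) auto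
  moreover have "0 \<le> (1 - k) * ((1 + p) / 2) * (s' - s)"
    using assms p0 by (intro mult_nonneg_nonneg) auto
  moreover have "\<bar>z - r / 2\<bar> - (r' - r) / 2 \<le> \<bar>z - r' / 2\<bar>"
    using \<open>r \<le> r'\<close> by (simp add: abs_if field_simps)
  then have "(1 - p) * (\<bar>z - r / 2\<bar> - (r' - r) / 2) \<le> (1 - p) * \<bar>z - r' / 2\<bar>"
    using p(2) by (intro mult_left_mono) auto
  moreover have "\<bar>z - r\<bar> = r - z" "\<bar>z - r'\<bar> = r' - z"
    using assms by auto
  ultimately show ?thesis
    unfolding mixed_cost_def end_cost_def by (simp add: field_simps)
qed

text \<open>No edge end involved lies beyond the agent at \<open>r\<close>, so the cost change is
  linear. The halved edge contributes half of what the first edge does, hence the factor p + (1 - p)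
  / 2 = (1 + p) / 2.\<close>

lemma mixed_cost_extreme_agent:
  assumes "r' \<le> r" "0 \<le> r"
  shows "mixed_cost k p r r' s' - mixed_cost k p r r s
    = (1 + p) / 2 * ((1 + k) * (r - r') - (1 - k) * (s - s'))"
proof -
  have "\<bar>r - r\<bar> = 0" "\<bar>r - r'\<bar> = r - r'" "\<bar>r - r / 2\<bar> = r / 2" "\<bar>r - r' / 2\<bar> = r - r' / 2"
    using assms by auto
  then show ?thesis
    unfolding mixed_cost_def end_cost_def by (simp add: field_simps)
qed

lemma mixed_cost_shrink:
  assumes "0 \<le> k" "k < 1" "0 \<le> p" "0 \<le> r" "r' \<le> r" "s \<le> s'"
  shows "mixed_cost k p r r s \<le> mixed_cost k p r r' s'"
proof -
  have "0 \<le> (1 + k) * (r - r')" "0 \<le> (1 - k) * (s' - s)"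
    using assms by auto
  then have "0 \<le> (1 + p) / 2 * ((1 + k) * (r - r') - (1 - k) * (s - s'))"
    using assms by (intro mult_nonneg_nonneg) (auto simp: algebra_simps)
  then show ?thesis
    using mixed_cost_extreme_agent[of r' r k p s' s] assms by linarith
qed

lemma mixed_cost_shrink_both:
  assumes "0 \<le> k" "0 \<le> p" "0 \<le> r" "0 \<le> s" "r' \<le> r" "s' \<le> s"
  shows "mixed_cost k p r r s \<le> mixed_cost k p r r' s'
    \<or> mixed_cost k p s s r \<le> mixed_cost k p s s' r'"
proof -
  \<comment> \<open>Up to the common nonnegative factor (1 + p) / 2, \<open>?u\<close> and
    \<open>?v\<close> are the cost changes of the two extreme agents. Only their signs matter, and
    the sum rules out that both are negative.\<close>
  let ?u = "(1 + k) * (r - r') - (1 - k) * (s - s')"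
  let ?v = "(1 + k) * (s - s') - (1 - k) * (r - r')"
  have "?u + ?v = 2 * (k * ((r - r') + (s - s')))"
    by (simp add: algebra_simps)
  moreover have "0 \<le> k * ((r - r') + (s - s'))"
    using assms by simp
  ultimately have "0 \<le> ?u \<or> 0 \<le> ?v" by linarith
  then have "0 \<le> (1 + p) / 2 * ?u \<or> 0 \<le> (1 + p) / 2 * ?v"
    using assms by (meson add_nonneg_nonneg divide_nonneg_nonneg mult_nonneg_nonneg zero_le_numeral zero_le_one)
  then show ?thesis
    using mixed_cost_extreme_agent[of r' r k p s' s] mixed_cost_extreme_agent[of s' s k p r' r]
      assms by linarith
qed

section \<open>Expected costs of the mechanism and its extreme agents\<close>

lemma expected_cost_RandMaxCost:
  assumes "0 \<le> k" "k < 1"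
  shows "expected_cost k obs (RandMaxCost n k obs x) z =
    rand_prob k * cost k obs (x_r n obs x, y_l n obs x) z +
    (1 - rand_prob k) * cost k obs (x_r n obs x / 2, (y_l n obs x + 1) / 2) z"
  unfolding expected_cost_def RandMaxCost_def
  using rand_prob_bounds[OF assms] by simp

lemma expected_cost_left:
  assumes "0 \<le> k" "k < 1" "z < obs"
  shows "expected_cost k obs (RandMaxCost n k obs x) z =
    mixed_cost k (rand_prob k) z (x_r n obs x) (1 - y_l n obs x)"
proof -
  have half: "1 - (y_l n obs x + 1) / 2 = (1 - y_l n obs x) / 2" by (simp add: field_simps)
  show ?thesis
    unfolding expected_cost_RandMaxCost[OF assms(1,2)] cost_left[OF assms(3)] half mixed_cost_def ..
qed

lemma expected_cost_right:
  assumes "0 \<le> k" "k < 1" "obs < z"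
  shows "expected_cost k obs (RandMaxCost n k obs x) z =
    mixed_cost k (rand_prob k) (1 - z) (1 - y_l n obs x) (x_r n obs x)"
proof -
  have half: "1 - (y_l n obs x + 1) / 2 = (1 - y_l n obs x) / 2" by (simp add: field_simps)
  show ?thesis
    unfolding expected_cost_RandMaxCost[OF assms(1,2)] cost_right[OF assms(3)] half mixed_cost_def ..
qed

lemma expected_max_cost_RandMaxCost:
  assumes "0 \<le> k" "k < 1"
  shows "expected_max_cost n k obs (RandMaxCost n k obs x) x =
    rand_prob k * max_cost n k obs (x_r n obs x, y_l n obs x) x +
    (1 - rand_prob k) * max_cost n k obs (x_r n obs x / 2, (y_l n obs x + 1) / 2) x"
  unfolding expected_max_cost_def RandMaxCost_def
  using rand_prob_bounds[OF assms] by simp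

lemma finite_agents [simp]: "finite (left_agents n obs x)" "finite (right_agents n obs x)"
  by (simp_all add: left_agents_def right_agents_def)

lemma profile_cases:
  assumes "x \<in> profiles n obs" "i \<in> {1..n}"
  obtains (left) "i \<in> left_agents n obs x" "x i < obs" "0 \<le> x i"
  | (right) "i \<in> right_agents n obs x" "obs < x i" "x i \<le> 1"
  using assms unfolding profiles_def left_agents_def right_agents_def by fastforce

lemma x_r_ge: "i \<in> left_agents n obs x \<Longrightarrow> x i \<le> x_r n obs x"
  unfolding x_r_def by (intro Max_ge) auto

lemma y_l_le: "i \<in> right_agents n obs x \<Longrightarrow> y_l n obs x \<le> x i"
  unfolding y_l_def by (intro Min_le) auto

lemma x_r_attained:
  assumes "x \<in> profiles n obs"
  obtains i where "i \<in> left_agents n obs x" "x_r n obs x = x i"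
proof -
  have "x_r n obs x \<in> x ` left_agents n obs x"
    unfolding x_r_def using assms by (intro Max_in) (auto simp: profiles_def)
  then show ?thesis using that by blast
qed

lemma y_l_attained:
  assumes "x \<in> profiles n obs"
  obtains i where "i \<in> right_agents n obs x" "y_l n obs x = x i"
proof -
  have "y_l n obs x \<in> x ` right_agents n obs x"
    unfolding y_l_def using assms by (intro Min_in) (auto simp: profiles_def)
  then show ?thesis using that by blast
qed

lemma x_r_bounds:
  assumes "x \<in> profiles n obs"
  shows "0 \<le> x_r n obs x" "x_r n obs x < obs"
proof -
  obtain i where i: "i \<in> left_agents n obs x" "x_r n obs x = x i"
    using x_r_attained[OF assms] .
  then have "i \<in> {1..n}" by (simp add: left_agents_def)
  with assms show "0 \<le> x_r n obs x" "x_r n obs x < obs"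
    by (cases rule: profile_cases; use i in \<open>simp add: left_agents_def\<close>)+
qed

lemma y_l_bounds:
  assumes "x \<in> profiles n obs"
  shows "obs < y_l n obs x" "y_l n obs x \<le> 1"
proof -
  obtain i where i: "i \<in> right_agents n obs x" "y_l n obs x = x i"
    using y_l_attained[OF assms] .
  then have "i \<in> {1..n}" by (simp add: right_agents_def)
  with assms show "obs < y_l n obs x" "y_l n obs x \<le> 1"
    by (cases rule: profile_cases; use i in \<open>simp add: right_agents_def\<close>)+
qed

lemma RandMaxCost_randomized_mechanism:
  assumes "0 < obs" "obs < 1"
  shows "randomized_mechanism n obs (RandMaxCost n k obs)"
  unfolding randomized_mechanism_def RandMaxCost_def edges_def
  using x_r_bounds y_l_bounds assms by (fastforce simp: field_simps)

section \<open>Group strategyproofness\<close>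

text \<open>A misreport stays in the region of the true location, so no agent crosses the obstacle
  and the two extremes are still taken over the same index sets.\<close>

lemma override_on_agents:
  assumes x: "x \<in> profiles n obs" and S: "S \<subseteq> {1..n}"
    and reg: "\<forall>i\<in>S. x' i \<in> region obs (x i)"
  shows "left_agents n obs (override_on x x' S) = left_agents n obs x"
    "right_agents n obs (override_on x x' S) = right_agents n obs x"
    "override_on x x' S \<in> profiles n obs"
proof -
  let ?x = "override_on x x' S"
  have side: "?x i \<in> {0..<obs} \<union> {obs<..1} \<and> (?x i < obs \<longleftrightarrow> x i < obs)
      \<and> (obs < ?x i \<longleftrightarrow> obs < x i)"
    if i: "i \<in> {1..n}" for i
  proof -
    have "x i \<in> {0..<obs} \<union> {obs<..1}"
      using x i by (auto simp: profiles_def)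
    moreover have "i \<in> S \<Longrightarrow> x' i \<in> region obs (x i)"
      using reg by blast
    ultimately show ?thesis
      by (cases "i \<in> S") (auto simp: region_def split: if_splits)
  qed
  show left: "left_agents n obs ?x = left_agents n obs x"
    and right: "right_agents n obs ?x = right_agents n obs x"
    unfolding left_agents_def right_agents_def using side by blast+
  show "?x \<in> profiles n obs"
    using x side left right unfolding profiles_def by blast
qed

lemma RandMaxCost_group_strategyproof:
  assumes k: "0 \<le> k" "k < 1"
  shows "group_strategyproof n k obs (RandMaxCost n k obs)"
  unfolding group_strategyproof_def
proof (intro allI impI)
  fix S and x x' :: "nat \<Rightarrow> real"
  assume ne: "S \<noteq> {}" and S: "S \<subseteq> {1..n}" and x: "x \<in> profiles n obs"
    and reg: "\<forall>i\<in>S. x' i \<in> region obs (x i)"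
  define X where "X = override_on x x' S"
  note agents = override_on_agents[OF x S reg, folded X_def]
  define p where "p = rand_prob k"
  have p: "0 \<le> p" "p \<le> 1" "(1 + k) / (3 - k) \<le> p"
    using rand_prob_bounds[OF k] by (auto simp: p_def rand_prob_def)
  define r s r' s' where "r = x_r n obs x" and "s = 1 - y_l n obs x"
    and "r' = x_r n obs X" and "s' = 1 - y_l n obs X"
  note rs_defs = r_def s_def r'_def s'_def
  have r0: "0 \<le> r" and s0: "0 \<le> s"
    using x_r_bounds[OF x] y_l_bounds[OF x] by (auto simp: rs_defs)
  let ?E = "\<lambda>y i. expected_cost k obs (RandMaxCost n k obs y) (x i)"
  have left: "?E x i = mixed_cost k p (x i) r s" "?E X i = mixed_cost k p (x i) r' s'" "x i \<le> r"
    if "i \<in> left_agents n obs x" for i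
    using that x_r_ge[OF that] k
    by (simp_all add: expected_cost_left rs_defs p_def left_agents_def)
  have right: "?E x i = mixed_cost k p (1 - x i) s r" "?E X i = mixed_cost k p (1 - x i) s' r'"
      "1 - x i \<le> s"
    if "i \<in> right_agents n obs x" for i
    using that y_l_le[OF that] k
    by (simp_all add: expected_cost_right rs_defs p_def right_agents_def)
  obtain i where i: "i \<in> left_agents n obs x" "r = x i"
    using x_r_attained[OF x] unfolding r_def .
  obtain j where j: "j \<in> right_agents n obs x" "1 - s = x j"
    using y_l_attained[OF x] unfolding s_def by auto
  \<comment> \<open>The maximum cannot fall while an agent attaining it reports truthfully.\<close>
  have iS: "i \<in> S" if "r' < r"
  proof (rule ccontr)
    assume "i \<notin> S"
    then have "X i = r" using i by (simp add: X_def)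
    then show False using x_r_ge[of i n obs X] i(1) agents(1) that by (simp add: r'_def)
  qed
  have jS: "j \<in> S" if "s' < s"
  proof (rule ccontr)
    assume "j \<notin> S"
    then have "X j = 1 - s" using j by (simp add: X_def)
    then show False using y_l_le[of j n obs X] j(1) agents(2) that by (simp add: s'_def)
  qed
  have Ei: "?E x i = mixed_cost k p r r s" "?E X i = mixed_cost k p r r' s'"
    using left[OF i(1)] i(2) by auto
  have Ej: "?E x j = mixed_cost k p s s r" "?E X j = mixed_cost k p s s' r'"
    using right[OF j(1)] j(2)[symmetric] by auto
  \<comment> \<open>If neither extreme is lowered, every member of \<open>S\<close> is a witness. If
    exactly one is lowered, the witness is the agent attaining it. If both are lowered, it is one of
    the two agents \<open>i\<close> and \<open>j\<close>.\<close>
  consider "r \<le> r'" "s \<le> s'" | "r' < r" "s \<le> s'" | "r \<le> r'" "s' < s" | "r' < r" "s' < s"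
    by linarith
  then have "\<exists>i\<in>S. ?E x i \<le> ?E X i"
  proof cases
    case 1
    obtain l where l: "l \<in> S" using ne by blast
    then have "l \<in> {1..n}" using S by blast
    with x have "?E x l \<le> ?E X l"
    proof (cases rule: profile_cases)
      case left': left
      then show ?thesis
        using mixed_cost_mono[OF k p(3,2), of "x l" r r' s s'] left[OF left'(1)] 1 by simp
    next
      case right': right
      then show ?thesis
        using mixed_cost_mono[OF k p(3,2), of "1 - x l" s s' r r'] right[OF right'(1)] 1 by simp
    qed
    then show ?thesis using l by blast
  next
    case 2
    then have "?E x i \<le> ?E X i"
      unfolding Ei using k p r0 by (intro mixed_cost_shrink) auto
    then show ?thesis using iS 2 by blast
  next
    case 3
    then have "?E x j \<le> ?E X j"
      unfolding Ej using k p s0 by (intro mixed_cost_shrink) auto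
    then show ?thesis using jS 3 by blast
  next
    case 4
    then have "?E x i \<le> ?E X i \<or> ?E x j \<le> ?E X j"
      unfolding Ei Ej using k p r0 s0 by (intro mixed_cost_shrink_both) auto
    then show ?thesis using iS jS 4 by blast
  qed
  then show "\<exists>i\<in>S. ?E x i \<le> expected_cost k obs (RandMaxCost n k obs (override_on x x' S)) (x i)"
    unfolding X_def .
qed

section \<open>Upper bound on the approximation ratio\<close>

lemma cost_le_max_cost: "i \<in> {1..n} \<Longrightarrow> cost k obs e (x i) \<le> max_cost n k obs e x"
  unfolding max_cost_def by (intro Max_ge) auto

lemma max_cost_le:
  assumes "0 < n" "\<And>i. i \<in> {1..n} \<Longrightarrow> cost k obs e (x i) \<le> c"
  shows "max_cost n k obs e x \<le> c"
  unfolding max_cost_def using assms by (subst Max_le_iff) auto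

definition ratio :: "real \<Rightarrow> real" where
  "ratio k = max ((4 - 2 * k) / (3 - k)) ((1 + k) / (1 + k\<^sup>2))"

text \<open>The map taking \<open>p\<close> to 1 + (1 - k) / (1 + k) * p is nondecreasing, so it
  commutes with the maximum and carries the two terms of \<open>rand_prob\<close> to those of
  \<open>ratio\<close>. Its value at \<open>rand_prob k\<close> is the quotient of the two cost
  bounds at \<open>m = 0\<close>, \<open>D = 1\<close>.\<close>

lemma ratio_rand_prob:
  assumes "0 \<le> k" "k < 1"
  shows "ratio k = 1 + (1 - k) / (1 + k) * rand_prob k"
proof -
  have pos: "0 < 1 + k\<^sup>2" by (simp add: add_pos_nonneg)
  have "(1 - k) / (1 + k) * ((1 + k) / (3 - k)) = (1 - k) / (3 - k)"
    using assms by simp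
  then have "1 + (1 - k) / (1 + k) * ((1 + k) / (3 - k)) = (4 - 2 * k) / (3 - k)"
    using assms by (simp add: field_simps)
  moreover have "k + k\<^sup>2 = (1 + k) * k" by (simp add: power2_eq_square algebra_simps)
  then have "(1 - k) / (1 + k) * ((k + k\<^sup>2) / (1 + k\<^sup>2)) = (1 - k) * k / (1 + k\<^sup>2)"
    using assms by simp
  then have "1 + (1 - k) / (1 + k) * ((k + k\<^sup>2) / (1 + k\<^sup>2)) = (1 + k) / (1 + k\<^sup>2)"
    using pos by (simp add: field_simps power2_eq_square)
  moreover have "0 \<le> (1 - k) / (1 + k)" using assms by simp
  ultimately show ?thesis
    unfolding ratio_def rand_prob_def by (simp add: max_mult_distrib_left max_add_distrib_right)
qed

text \<open>The weights (1 - k) / 2, (1 - k) / 2, \<open>k\<close> sum to 1 and make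
  \<open>a\<close> and \<open>b\<close> cancel once the absolute values are bounded below by r - a,
  s - b and a - m. The bound therefore holds for every edge.\<close>

lemma end_cost_average:
  assumes "0 \<le> k" "k < 1"
    and "end_cost k r a b \<le> c" "end_cost k s b a \<le> c" "end_cost k m a b \<le> c"
  shows "k + (1 - k) / 2 * (r + s) - k * m \<le> c"
proof -
  have "(1 - k) / 2 * (r - a - k * a + k + (1 - k) * b) \<le> (1 - k) / 2 * c"
    "(1 - k) / 2 * (s - b - k * b + k + (1 - k) * a) \<le> (1 - k) / 2 * c"
    "k * (a - m - k * a + k + (1 - k) * b) \<le> k * c"
    using assms unfolding end_cost_def by (intro mult_left_mono; auto)+
  then have "(1 - k) / 2 * (r - a - k * a + k + (1 - k) * b)
      + (1 - k) / 2 * (s - b - k * b + k + (1 - k) * a)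
      + k * (a - m - k * a + k + (1 - k) * b) \<le> c"
    by (simp add: field_simps)
  then show ?thesis by (simp add: field_simps)
qed

text \<open>After multiplication by 1 + k, the difference of the two sides splits into a multiple of
  \<open>m\<close>, nonnegative by the second lower bound on \<open>p\<close>, and a multiple of 1 -
  D. Both vanish at \<open>m = 0\<close>, \<open>D = 1\<close>.\<close>

lemma worst_case_ratio:
  assumes k: "0 \<le> k" "k < 1" and D: "0 \<le> D" "D \<le> 1" and m: "0 \<le> m"
  shows "k + (1 - k) * (1 + rand_prob k) / 2 * D - rand_prob k * m
    \<le> ratio k * (k + (1 - k) / 2 * D - k * m)"
proof -
  define p where "p = rand_prob k"
  have p: "0 \<le> p" using rand_prob_bounds[OF k] by (simp add: p_def)
  have "(k + k\<^sup>2) / (1 + k\<^sup>2) \<le> p" by (simp add: p_def rand_prob_def)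
  moreover have "0 < 1 + k\<^sup>2" by (simp add: add_pos_nonneg)
  ultimately have "k + k\<^sup>2 \<le> p * (1 + k\<^sup>2)" by (simp add: pos_divide_le_eq)
  then have 1: "0 \<le> (p * (1 + k\<^sup>2) - (k + k\<^sup>2)) * m" using m by simp
  have 2: "0 \<le> p * (1 - k) * k * (1 - D)"
    using k p D by (intro mult_nonneg_nonneg) auto
  have "(1 + k) * (ratio k * (k + (1 - k) / 2 * D - k * m)
      - (k + (1 - k) * (1 + p) / 2 * D - p * m))
    = ((1 + k) * ratio k) * (k + (1 - k) / 2 * D - k * m)
      - (1 + k) * (k + (1 - k) * (1 + p) / 2 * D - p * m)"
    by (simp add: algebra_simps)
  also have "(1 + k) * ratio k = 1 + k + (1 - k) * p"
    unfolding ratio_rand_prob[OF k] p_def using k by (simp add: field_simps)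
  also have "(1 + k + (1 - k) * p) * (k + (1 - k) / 2 * D - k * m)
      - (1 + k) * (k + (1 - k) * (1 + p) / 2 * D - p * m)
    = (p * (1 + k\<^sup>2) - (k + k\<^sup>2)) * m + p * (1 - k) * k * (1 - D)"
    by (simp add: field_simps power2_eq_square)
  finally have "0 \<le> (1 + k) * (ratio k * (k + (1 - k) / 2 * D - k * m)
      - (k + (1 - k) * (1 + p) / 2 * D - p * m))"
    using 1 2 by linarith
  then show ?thesis using k by (simp add: zero_le_mult_iff p_def)
qed

lemma RandMaxCost_approximates:
  assumes n: "2 \<le> n" and k: "0 \<le> k" "k < 1"
  shows "approximates n k (RandMaxCost n k) (ratio k)"
  unfolding approximates_def
proof (intro ballI)
  fix obs :: real and x
  assume obs: "obs \<in> {0<..<1}" and x: "x \<in> profiles n obs"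
  define r s where "r = x_r n obs x" and "s = 1 - y_l n obs x"
  have rs: "0 \<le> r" "0 \<le> s" "r + s \<le> 1"
    using x_r_bounds[OF x] y_l_bounds[OF x] by (auto simp: r_def s_def)
  define d where "d i = (if x i < obs then x i else 1 - x i)" for i
  define m where "m = (MIN i\<in>{1..n}. d i)"
  have "m \<in> d ` {1..n}" unfolding m_def using n by (intro Min_in) auto
  then obtain j where j: "j \<in> {1..n}" "m = d j" by blast
  have m_le: "m \<le> d i" if "i \<in> {1..n}" for i
    unfolding m_def using that by (intro Min_le) auto
  have m0: "0 \<le> m"
    using x j(1) unfolding j(2) d_def by (cases rule: profile_cases) auto
  have y_l_half: "1 - (y_l n obs x + 1) / 2 = s / 2"
    by (simp add: s_def field_simps)
  \<comment> \<open>On this edge agent \<open>i\<close> pays exactly k + (1 - k) * (r + s) - d i, so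
    the least distance is the worst.\<close>
  have mc1: "max_cost n k obs (x_r n obs x, y_l n obs x) x \<le> k + (1 - k) * (r + s) - m"
  proof (rule max_cost_le)
    fix i assume i: "i \<in> {1..n}"
    with x show "cost k obs (x_r n obs x, y_l n obs x) (x i) \<le> k + (1 - k) * (r + s) - m"
    proof (cases rule: profile_cases)
      case left
      then show ?thesis
        using m_le[OF i] x_r_ge[OF left(1)]
        by (simp add: cost_left end_cost_def d_def algebra_simps flip: r_def s_def)
    next
      case right
      then show ?thesis
        using m_le[OF i] y_l_le[OF right(1)]
        by (simp add: cost_right end_cost_def d_def algebra_simps r_def s_def)
    qed
  qed (use n in simp)
  have mc2: "max_cost n k obs (x_r n obs x / 2, (y_l n obs x + 1) / 2) x
      \<le> k + (1 - k) * (r + s) / 2"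
  proof (rule max_cost_le)
    fix i assume i: "i \<in> {1..n}"
    \<comment> \<open>The bound is the cost of an agent at distance r / 2 (left) or s / 2 (right)
      from the midpoint. No agent is farther away, since its distance lies between 0 and
      \<open>r\<close> or \<open>s\<close>.\<close>
    have eq: "k + (1 - k) * (r + s) / 2 = r / 2 - k * (r / 2) + k + (1 - k) * (s / 2)"
      "k + (1 - k) * (r + s) / 2 = s / 2 - k * (s / 2) + k + (1 - k) * (r / 2)"
      by (simp_all add: field_simps)
    from x i show "cost k obs (x_r n obs x / 2, (y_l n obs x + 1) / 2) (x i)
        \<le> k + (1 - k) * (r + s) / 2"
    proof (cases rule: profile_cases)
      case left
      then have "\<bar>x i - r / 2\<bar> \<le> r / 2"
        using x_r_ge[OF left(1)] by (simp add: r_def abs_if field_simps)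
      then show ?thesis
        unfolding eq(1) using left by (simp add: cost_left y_l_half end_cost_def flip: r_def)
    next
      case right
      then have "\<bar>1 - x i - s / 2\<bar> \<le> s / 2"
        using y_l_le[OF right(1)] by (simp add: s_def abs_if field_simps)
      then show ?thesis
        unfolding eq(2) using right by (simp add: cost_right y_l_half end_cost_def flip: r_def)
    qed
  qed (use n in simp)
  have p: "0 \<le> rand_prob k" "0 \<le> 1 - rand_prob k"
    using rand_prob_bounds[OF k] by auto
  have "expected_max_cost n k obs (RandMaxCost n k obs x) x
      \<le> rand_prob k * (k + (1 - k) * (r + s) - m)
        + (1 - rand_prob k) * (k + (1 - k) * (r + s) / 2)"
    unfolding expected_max_cost_RandMaxCost[OF k]
    using mc1 mc2 p by (intro add_mono mult_left_mono)
  also have "\<dots> = k + (1 - k) * (1 + rand_prob k) / 2 * (r + s) - rand_prob k * m"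
    by (simp add: field_simps)
  also have "\<dots> \<le> ratio k * (k + (1 - k) / 2 * (r + s) - k * m)"
    using k rs m0 by (intro worst_case_ratio) auto
  also have "\<dots> \<le> ratio k * opt_max_cost n k obs x"
  proof (rule mult_left_mono)
    obtain e where e: "opt_max_cost n k obs x = max_cost n k obs e x"
      using opt_max_cost_attained[OF k _ _ x] obs by auto
    \<comment> \<open>Writing the right end as 1 - b turns it into the distance that
      \<open>end_cost\<close> expects.\<close>
    obtain a b where ab: "e = (a, 1 - b)"
    proof
      show "e = (fst e, 1 - (1 - snd e))" by simp
    qed
    let ?M = "max_cost n k obs e x"
    obtain i where i: "i \<in> left_agents n obs x" "r = x i"
      using x_r_attained[OF x] unfolding r_def .
    obtain l where l: "l \<in> right_agents n obs x" "1 - s = x l"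
      using y_l_attained[OF x] unfolding s_def by auto
    have ci: "end_cost k r a b \<le> ?M"
      using cost_le_max_cost[of i n k obs e x] i
      by (auto simp: left_agents_def ab cost_left)
    have cl: "end_cost k s b a \<le> ?M"
      using cost_le_max_cost[of l n k obs e x] l(1) l(2)[symmetric]
      by (auto simp: right_agents_def ab cost_right)
    note cj = cost_le_max_cost[OF j(1), of k obs e x]
    \<comment> \<open>The agent at distance \<open>m\<close> may be on either side; on the right the
      averaging is applied with the two sides exchanged.\<close>
    from x j(1) have "k + (1 - k) / 2 * (r + s) - k * m \<le> ?M"
    proof (cases rule: profile_cases)
      case left
      then have "end_cost k m a b \<le> ?M"
        using cj by (simp add: ab cost_left j(2) d_def)
      then show ?thesis using end_cost_average[OF k ci cl] by simp
    next
      case right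
      then have "end_cost k m b a \<le> ?M"
        using cj by (simp add: ab cost_right j(2) d_def)
      then show ?thesis using end_cost_average[OF k cl ci] by (simp add: add.commute)
    qed
    then show "k + (1 - k) / 2 * (r + s) - k * m \<le> opt_max_cost n k obs x"
      unfolding e .
    show "0 \<le> ratio k"
      unfolding ratio_rand_prob[OF k] using k p by simp
  qed
  finally show "expected_max_cost n k obs (RandMaxCost n k obs x) x
      \<le> ratio k * opt_max_cost n k obs x" .
qed

section \<open>Tightness of the ratio\<close>

text \<open>The profile with one agent at 0 and all others at 1 - s has \<open>r = 0\<close>,
  \<open>m = 0\<close> and \<open>D = s\<close>. The agent at 0 alone forces the stated expected
  maximum cost.\<close>

lemma approximation_lower_bound_instance:
  assumes n: "2 \<le> n" and k: "0 \<le> k" "k < 1" and s: "0 < s" "s < 1"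
    and \<beta>: "approximates n k (RandMaxCost n k) \<beta>"
  shows "k + (1 - k) * (1 + rand_prob k) / 2 * s \<le> \<beta> * (k + (1 - k) / 2 * s)"
proof -
  \<comment> \<open>Any point strictly between 0 and 1 - s would separate the two groups; this is
    the midpoint.\<close>
  define obs where "obs = (1 - s) / 2"
  define x :: "nat \<Rightarrow> real" where "x i = (if i = 1 then 0 else 1 - s)" for i
  have obs: "0 < obs" "obs < 1" "obs < 1 - s" using s by (auto simp: obs_def)
  have L: "left_agents n obs x = {1}"
    using n obs by (auto simp: left_agents_def x_def)
  have R: "right_agents n obs x = {2..n}"
    using n obs by (auto simp: right_agents_def x_def)
  have x: "x \<in> profiles n obs"
    using n obs s L R by (auto simp: profiles_def x_def)
  have r: "x_r n obs x = 0" by (simp add: x_r_def L x_def)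
  obtain i where "i \<in> right_agents n obs x" "y_l n obs x = x i"
    using y_l_attained[OF x] .
  then have l: "y_l n obs x = 1 - s" by (auto simp: R x_def)
  have at: "1 \<in> {1..n}" "2 \<in> {1..n}" using n by auto
  have mc1: "k + (1 - k) * s \<le> max_cost n k obs (0, 1 - s) x"
    using cost_le_max_cost[OF at(1), of k obs "(0, 1 - s)" x] obs
    by (simp add: cost_left end_cost_def x_def)
  have mc2: "k + (1 - k) * s / 2 \<le> max_cost n k obs (0, 1 - s / 2) x"
    using cost_le_max_cost[OF at(1), of k obs "(0, 1 - s / 2)" x] obs
    by (simp add: cost_left end_cost_def x_def)
  \<comment> \<open>On the mechanism's own second edge both groups pay the same, which gives the
    upper bound on the optimum.\<close>
  have mc2': "max_cost n k obs (0, 1 - s / 2) x \<le> k + (1 - k) / 2 * s"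
  proof (rule max_cost_le)
    fix i :: nat
    show "cost k obs (0, 1 - s / 2) (x i) \<le> k + (1 - k) / 2 * s"
      using obs s by (auto simp: cost_left cost_right end_cost_def x_def field_simps)
  qed (use n in simp)
  have "(0, 1 - s / 2) \<in> edges obs"
    using obs s by (auto simp: edges_def)
  then have opt: "opt_max_cost n k obs x \<le> k + (1 - k) / 2 * s"
    using opt_max_cost_attained[OF k obs(1,2) x] mc2' by fastforce
  obtain a b where e: "opt_max_cost n k obs x = max_cost n k obs (a, b) x"
    and ab: "0 \<le> a" "a < b" "b \<le> 1"
    using opt_max_cost_attained[OF k obs(1,2) x] by (fastforce simp: edges_def)
  have "0 \<le> cost k obs (a, b) (x 1)"
    using k ab by (simp add: cost_def)
  then have opt0: "0 \<le> opt_max_cost n k obs x"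
    using cost_le_max_cost[OF at(1), of k obs "(a, b)" x] e by simp
  have p: "0 \<le> rand_prob k" "0 \<le> 1 - rand_prob k"
    using rand_prob_bounds[OF k] by auto
  have "k + (1 - k) * (1 + rand_prob k) / 2 * s
      = rand_prob k * (k + (1 - k) * s) + (1 - rand_prob k) * (k + (1 - k) * s / 2)"
    by (simp add: field_simps)
  also have "\<dots> \<le> expected_max_cost n k obs (RandMaxCost n k obs x) x"
  proof -
    have half: "(1 - s + 1) / 2 = 1 - s / 2" by (simp add: field_simps)
    show ?thesis
      unfolding expected_max_cost_RandMaxCost[OF k] r l half div_0
      using mc1 mc2 p by (intro add_mono mult_left_mono)
  qed
  also have "\<dots> \<le> \<beta> * opt_max_cost n k obs x"
    using \<beta> obs x unfolding approximates_def by auto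
  finally have le: "k + (1 - k) * (1 + rand_prob k) / 2 * s \<le> \<beta> * opt_max_cost n k obs x" .
  \<comment> \<open>Replacing the optimum by its upper bound requires \<open>\<beta>\<close> to be
    nonnegative. Strict positivity must come from \<open>s\<close>, as \<open>k\<close> may be
    0.\<close>
  have "0 < (1 - k) * (1 + rand_prob k) / 2 * s"
    using k p s by (intro mult_pos_pos divide_pos_pos) auto
  then have "0 < \<beta> * opt_max_cost n k obs x" using le k by linarith
  then have "0 \<le> \<beta>" using opt0 by (simp add: zero_less_mult_iff)
  then have "\<beta> * opt_max_cost n k obs x \<le> \<beta> * (k + (1 - k) / 2 * s)"
    using opt by (intro mult_left_mono)
  then show ?thesis using le by linarith
qed

text \<open>The instance with s = 1 would leave no room for the obstacle, so the bound is taken in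
  the limit from the left. Both sides are affine in \<open>s\<close>, and at 1 the factor of
  \<open>\<beta>\<close> is (1 + k) / 2.\<close>

lemma RandMaxCost_ratio_least:
  assumes n: "2 \<le> n" and k: "0 \<le> k" "k < 1"
    and \<beta>: "approximates n k (RandMaxCost n k) \<beta>"
  shows "ratio k \<le> \<beta>"
proof -
  let ?f = "\<lambda>s::real. k + (1 - k) * (1 + rand_prob k) / 2 * s"
  let ?g = "\<lambda>s::real. \<beta> * (k + (1 - k) / 2 * s)"
  have "(?f \<longlongrightarrow> ?f 1) (at_left 1)" "(?g \<longlongrightarrow> ?g 1) (at_left 1)"
    by (intro tendsto_intros)+
  moreover have "eventually (\<lambda>s. ?f s \<le> ?g s) (at_left 1)"
    using eventually_at_left_real[of 0 "1::real"] approximation_lower_bound_instance[OF n k _ _ \<beta>]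
    by (auto elim!: eventually_mono)
  ultimately have "?f 1 \<le> ?g 1"
    by (intro tendsto_le[of "at_left 1" ?g _ ?f]) auto
  then show ?thesis
    unfolding ratio_rand_prob[OF k] using k by (simp add: field_simps)
qed

theorem theorem7:
  fixes n :: nat and k :: real
  assumes "2 \<le> n" and "0 \<le> k" and "k < 1"
  shows "(\<forall>obs\<in>{0<..<1}. randomized_mechanism n obs (RandMaxCost n k obs) \<and>
            group_strategyproof n k obs (RandMaxCost n k obs)) \<and>
         is_approximation_ratio n k (RandMaxCost n k)
           (max ((4 - 2 * k) / (3 - k)) ((1 + k) / (1 + k\<^sup>2)))"
  using assms RandMaxCost_randomized_mechanism RandMaxCost_group_strategyproof
    RandMaxCost_approximates RandMaxCost_ratio_least
  unfolding is_approximation_ratio_def ratio_def by simp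

end
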